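(* Over the axiom system $\mathcal{M}^{-}$ (the Hilbert plane axioms without SAS), the ASA criterion is not deducible from the ray correspondence principle [RCT]; that is, ASA is not deducible from the axioms of $\mathcal{M}^{-}$ together with [RCT].
   Context: The axiom system $\mathcal{M}^{-}$ (a Hilbert plane with the SAS axiom removed) has points, lines, incidence, betweenness $A-B-C$, congruence $\equiv$ of segments and congruence $\equiv$ of angles as primitive notions, with axioms: [I1] Two distinct points are incident with a unique line. [I2] Every line is incident with at least two distinct points. [I3] There are three distinct points not all incident with one line. [O1] If $A-B-C$ then $A,B,C$ are distinct and collinear, and $C-B-A$. [O2] For distinct $B,D$ there are points $A,C,E$ on line $BD$ with $A-B-D$, $B-C-D$, $B-D-E$. [O3] Of three distinct collinear points exactly one is between the other two. [O4] For a line $l$ and points $A,B,C$ not on $l$: (i) if $A,B$ are on the same side of $l$ and $B,C$ are on the same side, then $A,C$ are on the same side; (ii) if $A,B$ are on opposite sides and $B,C$ are on opposite sides, then $A,C$ are on the same side. (Distinct points $X,Y$ not on $l$ are on opposite sides of $l$ if segment $XY$ meets $l$, otherwise on the same side; a point is on the same side as itself.) [C1] If $A\neq B$ and $r$ is a ray from $A'$, there is a unique $B'\ne A'$ on $r$ with $AB\equiv A'B'$. [C2] If $AB\equiv CD$ and $AB\equiv EF$ then $CD\equiv EF$; every segment is congruent to itself. [C3] If $A-B-C$, $A'-B'-C'$, $AB\equiv A'B'$, $BC\equiv B'C'$, then $AC\equiv A'C'$. [C4] Given an angle $\angle BAC$ and a ray $\overrightarrow{A'B'}$, there is a unique ray $\overrightarrow{A'C'}$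 on a given side of line $A'B'$ with $\angle B'A'C'\equiv\angle BAC$. [C5] If $\angle A\equiv\angle B$ and $\angle A\equiv\angle C$ then $\angle B\equiv\angle C$; every angle is congruent to itself. Segments and angles are unordered ($AB=BA$, $\angle ABC=\angle CBA$); an angle consists of two rays with common origin that are neither equal nor opposite. The interior of $\angle ABC$ is the set of points on the same side of line $BA$ as $C$ and on the same side of line $BC$ as $A$. A ray $\overrightarrow{BG}$ is between $\overrightarrow{BA}$ and $\overrightarrow{BC}$ if $G$ is in the interior of $\angle ABC$. Triangles have noncollinear vertices; $\triangle ABC\equiv\triangle DEF$ means that, under $A\mapsto D$, $B\mapsto E$, $C\mapsto F$, all corresponding sides and all corresponding angles are congruent. Principles (universally quantified): ASA: $\angle BAC\equiv\angle EDF$, $AB\equiv DE$, $\angle ABC\equiv\angle DEF$ imply $\triangle ABC\equiv\triangle DEF$. [RCT]: Given $\angle ABC\equiv\angle DEF$, for every ray $\overrightarrow{BG}$ between $\overrightarrow{BA}$ and $\overrightarrow{BC}$ there exists a unique ray $\overrightarrow{EH}$ between $\overrightarrow{ED}$ and $\overrightarrow{EF}$ such that $\angle GBC\equiv\angle HEF$ and $\angle ABG\equiv\angle DEH$. *)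

theory Defs
  imports Complex_Main
begin

text \<open>
  Points and lines are the elements of two types. Congruence of segments and of angles are
  relations between the segments and the angles themselves: a segment is a set of points and an
  angle is the unordered pair of its two rays, so neither relation can depend on the order of the
  endpoints or on the points chosen to name a ray.
\<close>

locale plane_structure =
  fixes incid :: "'p \<Rightarrow> 'l \<Rightarrow> bool"
    and betw :: "'p \<Rightarrow> 'p \<Rightarrow> 'p \<Rightarrow> bool"
    and seg_cong :: "'p set \<Rightarrow> 'p set \<Rightarrow> bool"
    and ang_cong :: "'p set set \<Rightarrow> 'p set set \<Rightarrow> bool"
begin

definition collinear :: "'p \<Rightarrow> 'p \<Rightarrow> 'p \<Rightarrow> bool" where
  "collinear A B C \<longleftrightarrow> (\<exists>l. incid A l \<and> incid B l \<and> incid C l)"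

definition line :: "'p \<Rightarrow> 'p \<Rightarrow> 'l" where
  "line A B = (THE l. incid A l \<and> incid B l)"

definition segment :: "'p \<Rightarrow> 'p \<Rightarrow> 'p set" where
  "segment A B = {A, B} \<union> {X. betw A X B}"

text \<open>The ray from \<open>A\<close> through \<open>B\<close>, including its origin; meaningful for \<open>A \<noteq> B\<close>.\<close>

definition ray :: "'p \<Rightarrow> 'p \<Rightarrow> 'p set" where
  "ray A B = segment A B \<union> {X. betw A B X}"

definition opposite_side :: "'l \<Rightarrow> 'p \<Rightarrow> 'p \<Rightarrow> bool" where
  "opposite_side l X Y \<longleftrightarrow>
     \<not> incid X l \<and> \<not> incid Y l \<and> X \<noteq> Y \<and> (\<exists>Z\<in>segment X Y. incid Z l)"

definition same_side :: "'l \<Rightarrow> 'p \<Rightarrow> 'p \<Rightarrow> bool" where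
  "same_side l X Y \<longleftrightarrow>
     \<not> incid X l \<and> \<not> incid Y l \<and> (X = Y \<or> \<not> opposite_side l X Y)"

text \<open>The vertex is the middle argument.\<close>

definition angle :: "'p \<Rightarrow> 'p \<Rightarrow> 'p \<Rightarrow> 'p set set" where
  "angle A B C = {ray B A, ray B C}"

text \<open>
  The rays \<open>ray B A\<close> and \<open>ray B C\<close> do form an angle: they are neither equal nor, as
  \<open>betw A B C\<close> would express, opposite.
\<close>

definition is_angle :: "'p \<Rightarrow> 'p \<Rightarrow> 'p \<Rightarrow> bool" where
  "is_angle A B C \<longleftrightarrow> A \<noteq> B \<and> C \<noteq> B \<and> ray B A \<noteq> ray B C \<and> \<not> betw A B C"

definition angle_interior :: "'p \<Rightarrow> 'p \<Rightarrow> 'p \<Rightarrow> 'p set" where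
  "angle_interior A B C = {G. same_side (line B A) G C \<and> same_side (line B C) G A}"

definition is_triangle :: "'p \<Rightarrow> 'p \<Rightarrow> 'p \<Rightarrow> bool" where
  "is_triangle A B C \<longleftrightarrow> \<not> collinear A B C"

definition triangle_cong :: "'p \<Rightarrow> 'p \<Rightarrow> 'p \<Rightarrow> 'p \<Rightarrow> 'p \<Rightarrow> 'p \<Rightarrow> bool" where
  "triangle_cong A B C D E F \<longleftrightarrow>
     seg_cong (segment A B) (segment D E) \<and>
     seg_cong (segment B C) (segment E F) \<and>
     seg_cong (segment A C) (segment D F) \<and>
     ang_cong (angle B A C) (angle E D F) \<and>
     ang_cong (angle A B C) (angle D E F) \<and>
     ang_cong (angle A C B) (angle D F E)"

definition ASA :: bool where
  "ASA \<longleftrightarrow> (\<forall>A B C D E F.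
     is_triangle A B C \<longrightarrow> is_triangle D E F \<longrightarrow>
     ang_cong (angle B A C) (angle E D F) \<longrightarrow>
     seg_cong (segment A B) (segment D E) \<longrightarrow>
     ang_cong (angle A B C) (angle D E F) \<longrightarrow>
     triangle_cong A B C D E F)"

definition RCT :: bool where
  "RCT \<longleftrightarrow> (\<forall>A B C D E F.
     is_angle A B C \<longrightarrow> is_angle D E F \<longrightarrow> ang_cong (angle A B C) (angle D E F) \<longrightarrow>
     (\<forall>G\<in>angle_interior A B C.
        \<exists>!r. \<exists>H\<in>angle_interior D E F. r = ray E H \<and>
               ang_cong (angle G B C) (angle H E F) \<and>
               ang_cong (angle A B G) (angle D E H)))"

end

text \<open>
  In \<open>C4\<close> the given side of the line \<open>A'B'\<close> is the one containing the point \<open>P\<close>.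
\<close>

locale M_minus = plane_structure incid betw seg_cong ang_cong
  for incid :: "'p \<Rightarrow> 'l \<Rightarrow> bool"
    and betw :: "'p \<Rightarrow> 'p \<Rightarrow> 'p \<Rightarrow> bool"
    and seg_cong :: "'p set \<Rightarrow> 'p set \<Rightarrow> bool"
    and ang_cong :: "'p set set \<Rightarrow> 'p set set \<Rightarrow> bool" +
  assumes I1: "A \<noteq> B \<Longrightarrow> \<exists>!l. incid A l \<and> incid B l"
    and I2: "\<exists>A B. A \<noteq> B \<and> incid A l \<and> incid B l"
    and I3: "\<exists>A B C. distinct [A, B, C] \<and> \<not> collinear A B C"
    and O1: "betw A B C \<Longrightarrow> distinct [A, B, C] \<and> collinear A B C \<and> betw C B A"
    and O2: "B \<noteq> D \<Longrightarrow>
      \<exists>A C E. incid A (line B D) \<and> incid C (line B D) \<and> incid E (line B D) \<and>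
              betw A B D \<and> betw B C D \<and> betw B D E"
    and O3: "distinct [A, B, C] \<Longrightarrow> collinear A B C \<Longrightarrow>
      (betw B A C \<and> \<not> betw A B C \<and> \<not> betw A C B) \<or>
      (\<not> betw B A C \<and> betw A B C \<and> \<not> betw A C B) \<or>
      (\<not> betw B A C \<and> \<not> betw A B C \<and> betw A C B)"
    and O4_same: "same_side l A B \<Longrightarrow> same_side l B C \<Longrightarrow> same_side l A C"
    and O4_opposite: "opposite_side l A B \<Longrightarrow> opposite_side l B C \<Longrightarrow> same_side l A C"
    and C1: "A \<noteq> B \<Longrightarrow> A' \<noteq> P \<Longrightarrow>
      \<exists>!B'. B' \<noteq> A' \<and> B' \<in> ray A' P \<and> seg_cong (segment A B) (segment A' B')"
    and C2_trans: "A \<noteq> B \<Longrightarrow> C \<noteq> D \<Longrightarrow> E \<noteq> F \<Longrightarrow>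
      seg_cong (segment A B) (segment C D) \<Longrightarrow> seg_cong (segment A B) (segment E F) \<Longrightarrow>
      seg_cong (segment C D) (segment E F)"
    and C2_refl: "A \<noteq> B \<Longrightarrow> seg_cong (segment A B) (segment A B)"
    and C3: "betw A B C \<Longrightarrow> betw A' B' C' \<Longrightarrow>
      seg_cong (segment A B) (segment A' B') \<Longrightarrow> seg_cong (segment B C) (segment B' C') \<Longrightarrow>
      seg_cong (segment A C) (segment A' C')"
    and C4: "is_angle B A C \<Longrightarrow> A' \<noteq> B' \<Longrightarrow> \<not> incid P (line A' B') \<Longrightarrow>
      \<exists>!r. \<exists>C'. r = ray A' C' \<and> same_side (line A' B') C' P \<and>
              ang_cong (angle B' A' C') (angle B A C)"
    and C5_trans: "is_angle A B C \<Longrightarrow> is_angle D E F \<Longrightarrow> is_angle G H K \<Longrightarrow>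
      ang_cong (angle A B C) (angle D E F) \<Longrightarrow> ang_cong (angle A B C) (angle G H K) \<Longrightarrow>
      ang_cong (angle D E F) (angle G H K)"
    and C5_refl: "is_angle A B C \<Longrightarrow> ang_cong (angle A B C) (angle A B C)"

text \<open>
  That a statement is not deducible from the axioms is expressed as usual: it is not true in all
  models of the axioms. A quantification over models fixes the types of points and lines; here
  they are \<open>real \<times> real\<close> and \<open>(real \<times> real) + real\<close> (think of the lines
  \<open>y = m * x + b\<close> and \<open>x = c\<close>), both of the cardinality of the continuum. This is no
  restriction: the axioms and both principles are first-order in points and lines, and every
  model has infinitely many points and as many lines, so by completeness and Loewenheim-Skolem
  any underivable first-order sentence fails in a model of this size.
  The type \<open>(real \<times> real) set\<close> would be too large for the lines, as by \<open>I1\<close>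
  and \<open>I2\<close> there are no more lines than pairs of points.
\<close>

end

theory Submission imports Defs "HOL-Analysis.Analysis" begin

text \<open>
  The countermodel is the real plane with its usual lines, order and Euclidean angles, in which
  the length of a segment is the length of its projection to the first axis, or its Euclidean
  length if it is vertical. On each line this is a rescaled Euclidean length, so the segment
  axioms hold; all other axioms, and the ray correspondence principle, do not mention segment
  congruence and hold as in the Euclidean plane. The scale depends on the
  direction of a line, so ASA fails for a right isosceles triangle with legs on the axes and its
  copy turned by 45 degrees and enlarged by \<open>sqrt 2\<close>, whose hypotenuse is parallel to an axis.
\<close>

section \<open>The primitive notions of the countermodel\<close>

type_synonym point = "real \<times> real"

type_synonym line = "(real \<times> real) + real"

text \<open>The determinant of the two vectors: its sign tells on which side of the line along
  \<open>u\<close> the vector \<open>v\<close> points, and for unit vectors it is the sine of the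
  oriented angle.\<close>

definition cross :: "point \<Rightarrow> point \<Rightarrow> real" where
  "cross u v = fst u * snd v - snd u * fst v"

text \<open>The equation of the line as a function: \<open>Inl (m, b)\<close> stands for y = m * x +
  b and \<open>Inr c\<close> for x = c, so the sign of the value tells the two half-planes
  apart.\<close>

fun side :: "line \<Rightarrow> point \<Rightarrow> real" where
  "side (Inl (m, b)) p = snd p - m * fst p - b"
| "side (Inr c) p = fst p - c"

definition inc :: "point \<Rightarrow> line \<Rightarrow> bool" where
  "inc p l \<longleftrightarrow> side l p = 0"

definition btw :: "point \<Rightarrow> point \<Rightarrow> point \<Rightarrow> bool" where
  "btw A B C \<longleftrightarrow> B \<in> open_segment A C"

definition len :: "point \<Rightarrow> real" where
  "len u = (if fst u = 0 then \<bar>snd u\<bar> else \<bar>fst u\<bar>)"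

text \<open>Congruence receives segments as point sets, so endpoints are recovered existentially;
  \<open>scong_iff\<close> shows that their choice is immaterial.\<close>

definition scong :: "point set \<Rightarrow> point set \<Rightarrow> bool" where
  "scong S T \<longleftrightarrow> (\<exists>A B C D. S = closed_segment A B \<and> T = closed_segment C D \<and> len (B - A) = len (D - C))"

text \<open>Rays are described by origin and direction vector instead of a second point, which turns
  statements about angles into vector algebra.\<close>

definition halfline :: "point \<Rightarrow> point \<Rightarrow> point set" where
  "halfline A u = {A + t *\<^sub>R u | t. t \<ge> 0}"

text \<open>The scalar product of the unit vectors \<open>sgn u\<close> and \<open>sgn v\<close> is the cosine of the
  Euclidean angle.\<close>

definition acong :: "point set set \<Rightarrow> point set set \<Rightarrow> bool" where
  "acong S T \<longleftrightarrow> (\<exists>A u v B u' v'. u \<noteq> 0 \<and> v \<noteq> 0 \<and> u' \<noteq> 0 \<and> v' \<noteq> 0 \<and>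
     S = {halfline A u, halfline A v} \<and> T = {halfline B u', halfline B v'} \<and>
     sgn u \<bullet> sgn v = sgn u' \<bullet> sgn v')"

interpretation P: plane_structure inc btw scong acong .

section \<open>Determinants, unit vectors and directions\<close>

lemma cross_simps [simp]:
  "cross u u = 0" "cross 0 u = 0" "cross u 0 = 0"
  "cross (r *\<^sub>R u) v = r * cross u v" "cross u (r *\<^sub>R v) = r * cross u v"
  "cross (u + w) v = cross u v + cross w v" "cross u (v + w) = cross u v + cross u w"
  by (auto simp: cross_def algebra_simps)

lemma cross_commute: "cross u v = - cross v u"
  by (simp add: cross_def)

lemma cross_eq_0:
  assumes "cross u v = 0" "u \<noteq> 0"
  obtains k where "v = k *\<^sub>R u"
proof (cases "fst u = 0")
  case True
  with assms have "snd u \<noteq> 0" by (simp add: prod_eq_iff)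
  with True assms have "v = (snd v / snd u) *\<^sub>R u"
    by (auto simp: cross_def prod_eq_iff)
  then show ?thesis by (rule that)
next
  case False
  with assms have "v = (fst v / fst u) *\<^sub>R u"
    by (auto simp: cross_def prod_eq_iff field_simps)
  then show ?thesis by (rule that)
qed

text \<open>Lagrange's identity in the plane; for unit vectors it is the relation between cosine and
  sine.\<close>

lemma inner_cross_sq: "(u \<bullet> v)\<^sup>2 + (cross u v)\<^sup>2 = (u \<bullet> u) * (v \<bullet> v)"
  by (simp add: cross_def inner_prod_def power2_eq_square algebra_simps)

text \<open>The difference of \<open>v\<close> and \<open>w\<close> is both orthogonal and parallel
  to \<open>u\<close>, so it vanishes by Lagrange's identity.\<close>

lemma eq_if_inner_cross_eq:
  assumes "u \<noteq> 0" "u \<bullet> v = u \<bullet> w" "cross u v = cross u w"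
  shows "v = w"
proof -
  have "u \<bullet> (v - w) = 0" "cross u (v - w) = 0"
    using assms by (auto simp: inner_diff_right cross_def algebra_simps)
  then have "(u \<bullet> u) * ((v - w) \<bullet> (v - w)) = 0"
    using inner_cross_sq[of u "v - w"] by simp
  with assms show ?thesis by simp
qed

lemma cross_sgn: "cross (sgn u) (sgn v) = cross u v / (norm u * norm v)"
  by (simp add: sgn_div_norm field_simps)

lemma inner_sgn_self: "(u::point) \<noteq> 0 \<Longrightarrow> sgn u \<bullet> sgn u = 1"
  by (simp add: sgn_div_norm dot_square_norm power2_eq_square)

lemma sgn_unit: "(u::point) \<bullet> u = 1 \<Longrightarrow> sgn u = u"
  by (simp add: sgn_div_norm norm_eq_sqrt_inner)

lemma sgn_decomp: "(u::point) = norm u *\<^sub>R sgn u"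
  by (cases "u = 0") (simp_all add: sgn_div_norm)

text \<open>The cosine fixes the sine up to its sign, and the common side fixes the sign. This gives
  the uniqueness of rays in \<open>C4\<close> and in the ray correspondence principle.\<close>

lemma sgn_eq_if_same_side:
  assumes "u \<noteq> 0" "v \<noteq> 0" "w \<noteq> 0" "cross u v * cross u w > 0" "sgn u \<bullet> sgn v = sgn u \<bullet> sgn w"
  shows "sgn v = sgn w"
proof (rule eq_if_inner_cross_eq)
  show "sgn u \<noteq> 0" "sgn u \<bullet> sgn v = sgn u \<bullet> sgn w" using assms by (auto simp: sgn_zero_iff)
  have "(cross (sgn u) (sgn v))\<^sup>2 = (cross (sgn u) (sgn w))\<^sup>2"
    using inner_cross_sq[of "sgn u" "sgn v"] inner_cross_sq[of "sgn u" "sgn w"] assms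
    by (simp add: inner_sgn_self)
  moreover have "cross (sgn u) (sgn v) * cross (sgn u) (sgn w) > 0"
    using assms by (simp add: cross_sgn zero_less_mult_iff zero_less_divide_iff)
  ultimately show "cross (sgn u) (sgn v) = cross (sgn u) (sgn w)"
    by (smt (verit) mult_minus_left power2_eq_iff zero_le_square)
qed

text \<open>Rotating the unit vector along \<open>u\<close> by an angle of cosine \<open>c\<close>
  gives the existence half of \<open>C4\<close>; the sign of \<open>s\<close> selects the
  side.\<close>

lemma exists_direction:
  assumes "u \<noteq> 0" "\<bar>c\<bar> < 1" "s \<noteq> 0"
  obtains v where "v \<noteq> 0" "sgn u \<bullet> sgn v = c" "cross u v * s > 0"
proof -
  \<comment> \<open>\<open>d\<close> is the sine belonging to \<open>c\<close>, with the sign of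
    \<open>s\<close>.\<close>
  define d where "d = sgn s * sqrt (1 - c\<^sup>2)"
  have c2: "c\<^sup>2 < 1" using assms by (simp add: abs_square_less_1)
  have d2: "d\<^sup>2 = 1 - c\<^sup>2" using c2 assms by (simp add: d_def power_mult_distrib sgn_if)
  have ds: "d * s > 0" using c2 assms by (auto simp: d_def sgn_if zero_less_mult_iff)
  define e where "e = sgn u"
  have e: "e \<bullet> e = 1" using assms by (simp add: e_def inner_sgn_self)
  then have e': "fst e * fst e + snd e * snd e = 1" by (simp add: inner_prod_def)
  \<comment> \<open>\<open>v\<close> is the unit vector \<open>e\<close> under the rotation with
    cosine \<open>c\<close> and sine \<open>d\<close>.\<close>
  define v where "v = (c * fst e - d * snd e, c * snd e + d * fst e)"
  have "e \<bullet> v = c * (fst e * fst e + snd e * snd e)"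
    by (simp add: v_def inner_prod_def algebra_simps)
  then have ev: "e \<bullet> v = c" using e' by simp
  have "cross e v = d * (fst e * fst e + snd e * snd e)"
    by (simp add: v_def cross_def algebra_simps)
  then have cr: "cross e v = d" using e' by simp
  have "v \<bullet> v = 1" using inner_cross_sq[of e v] ev cr d2 e by simp
  then have "sgn v = v" "v \<noteq> 0" by (auto simp: sgn_unit)
  moreover have "cross u v = norm u * d"
    using cr by (metis cross_simps(4) e_def sgn_decomp)
  ultimately show ?thesis using that[of v] ev ds assms
    by (simp add: e_def mult.assoc)
qed

section \<open>Order, segments and rays in parameters\<close>

lemma btw_line:
  assumes "u \<noteq> 0"
  shows "btw (A + a *\<^sub>R u) (A + b *\<^sub>R u) (A + c *\<^sub>R u) \<longleftrightarrow> a < b \<and> b < c \<or> c < b \<and> b < a"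
proof -
  \<comment> \<open>A parametrisation of the line is affine and injective, so betweenness of points
    reduces to strict betweenness of real parameters.\<close>
  have eq: "(A + b *\<^sub>R u = (1 - t) *\<^sub>R (A + a *\<^sub>R u) + t *\<^sub>R (A + c *\<^sub>R u)) \<longleftrightarrow> b = a + t * (c - a)" for t
  proof -
    have "(1 - t) *\<^sub>R (A + a *\<^sub>R u) + t *\<^sub>R (A + c *\<^sub>R u) = A + (a + t * (c - a)) *\<^sub>R u"
      by (simp add: algebra_simps)
    then show ?thesis using assms by simp
  qed
  have "btw (A + a *\<^sub>R u) (A + b *\<^sub>R u) (A + c *\<^sub>R u) \<longleftrightarrow>
      a \<noteq> c \<and> (\<exists>t. 0 < t \<and> t < 1 \<and> b = a + t * (c - a))"
    using assms by (simp add: btw_def in_segment eq)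
  also have "\<dots> \<longleftrightarrow> a < b \<and> b < c \<or> c < b \<and> b < a"
  proof
    assume "a \<noteq> c \<and> (\<exists>t. 0 < t \<and> t < 1 \<and> b = a + t * (c - a))"
    then obtain t where t: "a \<noteq> c" "0 < t" "t < 1" "b = a + t * (c - a)" by blast
    have "c - b = (1 - t) * (c - a)" "b - a = t * (c - a)" using t by (simp_all add: algebra_simps)
    with t show "a < b \<and> b < c \<or> c < b \<and> b < a"
      by (smt (verit) mult_pos_pos mult_pos_neg)
  next
    assume "a < b \<and> b < c \<or> c < b \<and> b < a"
    then have "a \<noteq> c \<and> 0 < (b - a) / (c - a) \<and> (b - a) / (c - a) < 1 \<and> b = a + (b - a) / (c - a) * (c - a)"
      by (auto simp: zero_less_divide_iff divide_less_eq)
    then show "a \<noteq> c \<and> (\<exists>t. 0 < t \<and> t < 1 \<and> b = a + t * (c - a))" by blast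
  qed
  finally show ?thesis .
qed

lemma btw_line':
  assumes "u \<noteq> 0"
  shows "btw A (A + b *\<^sub>R u) (A + c *\<^sub>R u) \<longleftrightarrow> 0 < b \<and> b < c \<or> c < b \<and> b < 0"
  using btw_line[OF assms, of A 0 b c] by simp

lemma btwE:
  assumes "btw A B C"
  obtains t where "A \<noteq> C" "0 < t" "t < 1" "B = A + t *\<^sub>R (C - A)"
proof -
  obtain t where "A \<noteq> C" "0 < t" "t < 1" "B = (1 - t) *\<^sub>R A + t *\<^sub>R C"
    using assms by (auto simp: btw_def in_segment)
  then show ?thesis using that[of t] by (simp add: algebra_simps)
qed

lemma segment_eq: "P.segment A B = closed_segment A B"
  by (auto simp: P.segment_def btw_def open_segment_def)

text \<open>Parameters from 0 to 1 give the segment, and parameters above 1 give the points beyond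
  \<open>B\<close>.\<close>

lemma ray_eq:
  assumes "A \<noteq> B"
  shows "P.ray A B = halfline A (B - A)"
proof (intro equalityI subsetI)
  fix X assume "X \<in> P.ray A B"
  then consider "X \<in> closed_segment A B" | "btw A B X"
    by (auto simp: P.ray_def segment_eq)
  then show "X \<in> halfline A (B - A)"
  proof cases
    case 1
    then obtain t where "0 \<le> t" "X = (1 - t) *\<^sub>R A + t *\<^sub>R B" by (auto simp: in_segment)
    then have "X = A + t *\<^sub>R (B - A)" by (simp add: algebra_simps)
    with \<open>0 \<le> t\<close> show ?thesis by (auto simp: halfline_def)
  next
    case 2
    then obtain t where t: "0 < t" "B = A + t *\<^sub>R (X - A)" by (rule btwE)
    then have "X = A + (1 / t) *\<^sub>R (B - A)" by simp
    with t show ?thesis unfolding halfline_def by (smt (verit) divide_nonneg_pos mem_Collect_eq)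
  qed
next
  fix X assume "X \<in> halfline A (B - A)"
  then obtain t where t: "t \<ge> 0" "X = A + t *\<^sub>R (B - A)" by (auto simp: halfline_def)
  show "X \<in> P.ray A B"
  proof (cases "t \<le> 1")
    case True
    have "X = (1 - t) *\<^sub>R A + t *\<^sub>R B" using t by (simp add: algebra_simps)
    with True t have "X \<in> closed_segment A B" by (auto simp: in_segment)
    then show ?thesis by (simp add: P.ray_def segment_eq)
  next
    case False
    then have "btw A (A + 1 *\<^sub>R (B - A)) (A + t *\<^sub>R (B - A))"
      using assms by (subst btw_line') auto
    then show ?thesis using t by (simp add: P.ray_def)
  qed
qed

text \<open>With distinct origins each one would lie on the other ray, so the directions would be
  opposite, and a point of the second ray beyond \<open>A\<close> would leave the first.\<close>

lemma halfline_origin_eq: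
  assumes "u \<noteq> 0" "halfline A u = halfline B v"
  shows "A = B"
proof (rule ccontr)
  assume "A \<noteq> B"
  have "A + 0 *\<^sub>R u \<in> halfline A u" "B + 0 *\<^sub>R v \<in> halfline B v" unfolding halfline_def by blast+
  then have "A \<in> halfline B v" "B \<in> halfline A u" using assms(2) by auto
  then obtain s t where s: "s \<ge> 0" "B = A + s *\<^sub>R u" and t: "t \<ge> 0" "A = B + t *\<^sub>R v"
    unfolding halfline_def by blast
  from s t \<open>A \<noteq> B\<close> have pos: "s > 0" "t > 0" by (auto simp: less_le)
  have tv: "t *\<^sub>R v = - (s *\<^sub>R u)" using s t by (metis add.commute add_diff_cancel_left' minus_diff_eq)
  \<comment> \<open>Since \<open>A\<close> has parameter \<open>t\<close> on the second ray,
    parameter \<open>2 * t\<close> overshoots it and lands on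
    \<open>A - s *\<^sub>R u\<close>.\<close>
  have "B + (2 * t) *\<^sub>R v \<in> halfline B v" using pos by (force simp: halfline_def)
  then have "B + (2 * t) *\<^sub>R v \<in> halfline A u" using assms(2) by simp
  then obtain r where r: "r \<ge> 0" "B + (2 * t) *\<^sub>R v = A + r *\<^sub>R u"
    unfolding halfline_def by blast
  have "B + (2 * t) *\<^sub>R v = (B + t *\<^sub>R v) + t *\<^sub>R v" by (simp only: mult_2 scaleR_add_left add.assoc)
  also have "\<dots> = A + - (s *\<^sub>R u)" using t(2) tv by simp
  finally have "(s + r) *\<^sub>R u = 0" using r(2) by (simp add: scaleR_add_left)
  with pos r assms show False by simp
qed

text \<open>The unit vector is a canonical representative of the direction of a ray.\<close>

lemma halfline_eq_iff:
  assumes "u \<noteq> 0" "v \<noteq> 0"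
  shows "halfline A u = halfline B v \<longleftrightarrow> A = B \<and> sgn u = sgn v"
proof
  assume eq: "halfline A u = halfline B v"
  then have "A = B" using halfline_origin_eq assms by blast
  have "A + 1 *\<^sub>R u \<in> halfline A u" unfolding halfline_def using zero_le_one by blast
  then have "A + 1 *\<^sub>R u \<in> halfline A v" using eq \<open>A = B\<close> by simp
  then obtain t where t: "t \<ge> 0" "u = t *\<^sub>R v" by (auto simp: halfline_def)
  with assms have "t > 0" by (auto simp: less_le)
  with t \<open>A = B\<close> show "A = B \<and> sgn u = sgn v" by (simp add: sgn_scaleR)
next
  have sub: "halfline A u \<subseteq> halfline A v" if "u \<noteq> 0" "v \<noteq> 0" "sgn u = sgn v" for A u v
  proof
    fix X assume "X \<in> halfline A u"
    then obtain t where t: "t \<ge> 0" "X = A + t *\<^sub>R u" by (auto simp: halfline_def)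
    have "u = norm u *\<^sub>R sgn v" using that sgn_decomp[of u] by simp
    then have "u = (norm u / norm v) *\<^sub>R v" by (simp add: sgn_div_norm divide_inverse)
    then have "X = A + (t * (norm u / norm v)) *\<^sub>R v" using t by (metis scaleR_scaleR)
    moreover have "t * (norm u / norm v) \<ge> 0" using t by simp
    ultimately show "X \<in> halfline A v" unfolding halfline_def by blast
  qed
  assume "A = B \<and> sgn u = sgn v"
  then show "halfline A u = halfline B v" using sub[of u v A] sub[of v u A] assms by auto
qed

section \<open>Congruence of angles and of segments\<close>

lemma acong_iff:
  assumes "u \<noteq> 0" "v \<noteq> 0" "u' \<noteq> 0" "v' \<noteq> 0"
  shows "acong {halfline A u, halfline A v} {halfline B u', halfline B v'} \<longleftrightarrow>
    sgn u \<bullet> sgn v = sgn u' \<bullet> sgn v'"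
proof -
  \<comment> \<open>The unordered pair of rays determines the two unit vectors up to order, and the
    scalar product is symmetric.\<close>
  have wd: "sgn u \<bullet> sgn v = sgn x \<bullet> sgn y"
    if "{halfline A u, halfline A v} = {halfline C x, halfline C y}"
      "u \<noteq> 0" "v \<noteq> 0" "x \<noteq> 0" "y \<noteq> 0" for A C u v x y
    using that by (auto simp: doubleton_eq_iff halfline_eq_iff inner_commute)
  show ?thesis
  proof
    assume "acong {halfline A u, halfline A v} {halfline B u', halfline B v'}"
    then obtain C x y D x' y' where h: "x \<noteq> 0" "y \<noteq> 0" "x' \<noteq> 0" "y' \<noteq> 0"
      "{halfline A u, halfline A v} = {halfline C x, halfline C y}"
      "{halfline B u', halfline B v'} = {halfline D x', halfline D y'}"
      "sgn x \<bullet> sgn y = sgn x' \<bullet> sgn y'"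
      unfolding acong_def by metis
    show "sgn u \<bullet> sgn v = sgn u' \<bullet> sgn v'"
      using wd[OF h(5)] wd[OF h(6)] h assms by simp
  next
    assume "sgn u \<bullet> sgn v = sgn u' \<bullet> sgn v'"
    with assms show "acong {halfline A u, halfline A v} {halfline B u', halfline B v'}"
      unfolding acong_def
      by (intro exI[of _ A] exI[of _ u] exI[of _ v] exI[of _ B] exI[of _ u'] exI[of _ v']) simp
  qed
qed

lemma angle_cong_iff:
  assumes "A \<noteq> B" "C \<noteq> B" "D \<noteq> E" "F \<noteq> E"
  shows "acong (P.angle A B C) (P.angle D E F) \<longleftrightarrow>
    sgn (A - B) \<bullet> sgn (C - B) = sgn (D - E) \<bullet> sgn (F - E)"
  using assms by (simp add: P.angle_def ray_eq acong_iff)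

lemma len_simps: "len (t *\<^sub>R u) = \<bar>t\<bar> * len u" "len (- u) = len u"
  by (auto simp: len_def abs_mult)

lemma len_pos: "u \<noteq> 0 \<Longrightarrow> len u > 0"
  by (auto simp: len_def prod_eq_iff)

text \<open>A segment determines its endpoints up to order, and \<open>len\<close> is invariant
  under negation.\<close>

lemma scong_iff:
  "scong (P.segment A B) (P.segment C D) \<longleftrightarrow> len (B - A) = len (D - C)"
proof -
  have wd: "len (B - A) = len (D - C)" if "closed_segment A B = closed_segment C D" for A B C D
    using that len_simps(2)[of "D - C"] by (auto simp: closed_segment_eq doubleton_eq_iff)
  show ?thesis unfolding scong_def segment_eq using wd by metis
qed

section \<open>Lines and their sides\<close>

lemma side_affine: "side l ((1 - t) *\<^sub>R A + t *\<^sub>R B) = (1 - t) * side l A + t * side l B"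
  by (cases "(l, A)" rule: side.cases) (auto simp: algebra_simps)

text \<open>Along the segment \<open>side l\<close> is an affine function of the parameter; being
  nonzero at the ends, it has a zero exactly when its end values differ in sign. Plane separation
  thus becomes a sign rule.\<close>

lemma opposite_side_iff: "P.opposite_side l X Y \<longleftrightarrow> side l X * side l Y < 0"
proof
  assume "P.opposite_side l X Y"
  then obtain t where t: "side l X \<noteq> 0" "side l Y \<noteq> 0" "0 \<le> t" "t \<le> 1"
      "(1 - t) * side l X + t * side l Y = 0"
    by (auto simp: P.opposite_side_def segment_eq inc_def in_segment side_affine)
  then have "t \<noteq> 0" "t \<noteq> 1" by auto
  with t have t': "0 < t" "t < 1" by auto
  have "t * (side l X * side l Y) = side l X * (t * side l Y)" by simp
  also have "t * side l Y = - (1 - t) * side l X" using t(5) by linarith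
  also have "side l X * (- (1 - t) * side l X) = - ((1 - t) * (side l X * side l X))"
    by (simp add: algebra_simps)
  also have "\<dots> < 0" using t' t(1) by (auto simp: zero_less_mult_iff)
  finally show "side l X * side l Y < 0" using t' by (simp add: mult_less_0_iff)
next
  assume neg: "side l X * side l Y < 0"
  \<comment> \<open>The parameter at which the affine function with end values
    \<open>side l X\<close> and \<open>side l Y\<close> vanishes.\<close>
  define t where "t = side l X / (side l X - side l Y)"
  have d: "side l X - side l Y \<noteq> 0" using neg by (auto simp: mult_less_0_iff)
  have "0 \<le> t" "t \<le> 1" using neg
    by (auto simp: t_def mult_less_0_iff zero_le_divide_iff divide_le_eq)
  moreover have "(1 - t) * side l X + t * side l Y = 0"
    using d by (simp add: t_def field_simps)
  then have "side l ((1 - t) *\<^sub>R X + t *\<^sub>R Y) = 0" by (simp only: side_affine)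
  ultimately have "\<exists>Z\<in>closed_segment X Y. side l Z = 0"
    by (intro bexI[of _ "(1 - t) *\<^sub>R X + t *\<^sub>R Y"]) (auto simp: in_segment)
  with neg show "P.opposite_side l X Y"
    by (auto simp: P.opposite_side_def segment_eq inc_def)
qed

lemma same_side_iff: "P.same_side l X Y \<longleftrightarrow> side l X * side l Y > 0"
  by (auto simp: P.same_side_def opposite_side_iff inc_def mult_less_0_iff zero_less_mult_iff)

lemma ex1_line:
  assumes "A \<noteq> B"
  shows "\<exists>!l. inc A l \<and> inc B l"
proof (cases "fst A = fst B")
  case True
  show ?thesis
  proof (rule ex1I[of _ "Inr (fst A)"])
    fix l assume "inc A l \<and> inc B l"
    with True assms show "l = Inr (fst A)"
      by (cases "(l, A)" rule: side.cases) (auto simp: inc_def prod_eq_iff)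
  qed (use True in \<open>auto simp: inc_def\<close>)
next
  case False
  define m where "m = (snd B - snd A) / (fst B - fst A)"
  have m: "m * (fst B - fst A) = snd B - snd A" using False by (simp add: m_def)
  show ?thesis
  proof (rule ex1I[of _ "Inl (m, snd A - m * fst A)"])
    show "inc A (Inl (m, snd A - m * fst A)) \<and> inc B (Inl (m, snd A - m * fst A))"
      using m by (auto simp: inc_def algebra_simps)
  next
    fix l assume l: "inc A l \<and> inc B l"
    show "l = Inl (m, snd A - m * fst A)"
    proof (cases "(l, A)" rule: side.cases)
      case (1 k b p)
      with l have "k * (fst B - fst A) = m * (fst B - fst A)" "b = snd A - k * fst A"
        using m by (auto simp: inc_def algebra_simps)
      with 1 False show ?thesis by auto
    qed (use l False in \<open>auto simp: inc_def\<close>)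
  qed
qed

lemma inc_line:
  assumes "A \<noteq> B"
  shows "inc A (P.line A B)" "inc B (P.line A B)"
  using theI'[OF ex1_line[OF assms]] by (auto simp: P.line_def)

text \<open>Both sides are affine functions of \<open>X\<close> vanishing on the line, hence
  proportional. This removes the distinction between vertical and other lines.\<close>

lemma side_eq_cross:
  assumes "A \<noteq> B" "inc A l" "inc B l"
  obtains k where "k \<noteq> 0" "\<And>X. side l X = k * cross (B - A) (X - A)"
proof (cases "(l, A)" rule: side.cases)
  case (1 m b p)
  with assms have *: "snd A = m * fst A + b" "snd B = m * fst B + b" by (auto simp: inc_def)
  with assms have ne: "fst B - fst A \<noteq> 0" by (auto simp: prod_eq_iff)
  have "side l X = 1 / (fst B - fst A) * cross (B - A) (X - A)" for X
  proof -
    have "cross (B - A) (X - A) = (fst B - fst A) * side l X"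
      using 1 * by (simp add: cross_def algebra_simps)
    then show ?thesis using ne by simp
  qed
  with ne show ?thesis by (intro that[of "1 / (fst B - fst A)"]) auto
next
  case (2 c p)
  with assms have *: "fst A = c" "fst B = c" by (auto simp: inc_def)
  with assms have ne: "snd B - snd A \<noteq> 0" by (auto simp: prod_eq_iff)
  have "side l X = - 1 / (snd B - snd A) * cross (B - A) (X - A)" for X
  proof -
    have "cross (B - A) (X - A) = - (snd B - snd A) * side l X"
      using 2 * by (simp add: cross_def algebra_simps)
    then show ?thesis using ne by (simp add: divide_simps) (simp add: algebra_simps)
  qed
  with ne show ?thesis by (intro that[of "- 1 / (snd B - snd A)"]) auto
qed

lemma inc_line_iff: "A \<noteq> B \<Longrightarrow> inc X (P.line A B) \<longleftrightarrow> cross (B - A) (X - A) = 0"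
  by (metis inc_def inc_line mult_eq_0_iff side_eq_cross)

lemma same_side_line_iff:
  assumes "A \<noteq> B"
  shows "P.same_side (P.line A B) X Y \<longleftrightarrow> cross (B - A) (X - A) * cross (B - A) (Y - A) > 0"
proof -
  obtain k where k: "k \<noteq> 0" "\<And>X. side (P.line A B) X = k * cross (B - A) (X - A)"
    using side_eq_cross[OF assms inc_line[OF assms]] by metis
  \<comment> \<open>The proportionality factor enters squared, so its sign does not affect which
    points share a side.\<close>
  have "side (P.line A B) X * side (P.line A B) Y =
      (k * k) * (cross (B - A) (X - A) * cross (B - A) (Y - A))"
    by (simp add: k)
  moreover have "k * k > 0" using k by (auto simp: zero_less_mult_iff)
  ultimately show ?thesis by (simp add: same_side_iff zero_less_mult_iff)
qed

lemma collinear_iff: "P.collinear A B C \<longleftrightarrow> cross (B - A) (C - A) = 0"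
proof (cases "A = B")
  case True
  have "\<exists>l. inc B l \<and> inc C l"
  proof (cases "B = C")
    case False then show ?thesis using ex1_line by blast
  next
    case True
    \<comment> \<open>If all three points coincide, the vertical line through them serves as a
      witness.\<close>
    then show ?thesis by (intro exI[of _ "Inr (fst C)"]) (simp add: inc_def)
  qed
  with True show ?thesis by (auto simp: P.collinear_def cross_def)
next
  case False
  have "P.collinear A B C \<longleftrightarrow> inc C (P.line A B)"
    unfolding P.collinear_def using ex1_line[OF False] inc_line[OF False] by blast
  with False show ?thesis by (simp add: inc_line_iff)
qed

section \<open>Proper angles and their interiors\<close>

lemma is_angle_imp:
  assumes "P.is_angle A B C"
  shows "A \<noteq> B" "C \<noteq> B" "cross (A - B) (C - B) \<noteq> 0"
proof -
  show ne: "A \<noteq> B" "C \<noteq> B" using assms by (auto simp: P.is_angle_def)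
  show "cross (A - B) (C - B) \<noteq> 0"
  proof
    assume "cross (A - B) (C - B) = 0"
    then obtain k where k: "C - B = k *\<^sub>R (A - B)"
      using cross_eq_0[of "A - B" "C - B"] ne by auto
    then have "k \<noteq> 0" using ne by auto
    \<comment> \<open>Dependent arms are excluded in two ways: a positive factor makes the rays
      equal, a negative one puts the vertex between \<open>A\<close> and \<open>C\<close>.\<close>
    then consider "k > 0" | "k < 0" by linarith
    then show False
    proof cases
      case 1
      then have "P.ray B A = P.ray B C"
        using ne k by (simp add: ray_eq halfline_eq_iff sgn_scaleR)
      then show False using assms by (simp add: P.is_angle_def)
    next
      case 2
      then have "btw (B + 1 *\<^sub>R (A - B)) (B + 0 *\<^sub>R (A - B)) (B + k *\<^sub>R (A - B))"
        using ne by (subst btw_line) auto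
      then have "btw A B C" using k[symmetric] by simp
      then show False using assms by (simp add: P.is_angle_def)
    qed
  qed
qed

text \<open>A nonzero sine bounds the cosine strictly, by Lagrange's identity;
  \<open>exists_direction\<close> needs this bound when \<open>C4\<close> is verified.\<close>

lemma abs_cos_less_1:
  assumes "cross u v \<noteq> 0"
  shows "\<bar>sgn u \<bullet> sgn v\<bar> < 1"
proof -
  have nz: "u \<noteq> 0" "v \<noteq> 0" using assms by auto
  then have "cross (sgn u) (sgn v) \<noteq> 0" using assms by (simp add: cross_sgn)
  then have "(sgn u \<bullet> sgn v)\<^sup>2 < 1"
    using inner_cross_sq[of "sgn u" "sgn v"] nz
    by (metis inner_sgn_self less_add_same_cancel1 mult_1 zero_less_power2)
  then show ?thesis by (simp add: abs_square_less_1)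
qed

lemma angle_interior_iff:
  assumes "A \<noteq> B" "C \<noteq> B"
  shows "G \<in> P.angle_interior A B C \<longleftrightarrow>
    cross (A - B) (G - B) * cross (A - B) (C - B) > 0 \<and>
    cross (C - B) (G - B) * cross (C - B) (A - B) > 0"
  using assms by (simp add: P.angle_interior_def same_side_line_iff)

section \<open>Verification of the axioms\<close>

lemma plane_M_minus: "M_minus inc btw scong acong"
proof
  fix A B :: point
  show "A \<noteq> B \<Longrightarrow> \<exists>!l. inc A l \<and> inc B l" by (rule ex1_line)
next
  fix l
  show "\<exists>A B. A \<noteq> B \<and> inc A l \<and> inc B l"
  proof (cases "(l, 0::point)" rule: side.cases)
    case (1 m b p)
    then show ?thesis by (intro exI[of _ "(0, b)"] exI[of _ "(1, m + b)"]) (auto simp: inc_def)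
  next
    case (2 c p)
    then show ?thesis by (intro exI[of _ "(c, 0)"] exI[of _ "(c, 1)"]) (auto simp: inc_def)
  qed
next
  show "\<exists>A B C. distinct [A, B, C] \<and> \<not> P.collinear A B C"
    by (intro exI[of _ "(0, 0)"] exI[of _ "(1, 0)"] exI[of _ "(0, 1)"])
      (simp add: collinear_iff cross_def)
next
  fix A B C :: point assume b: "btw A B C"
  then obtain t where t: "A \<noteq> C" "0 < t" "t < 1" "B = A + t *\<^sub>R (C - A)" by (rule btwE)
  then have "P.collinear A B C" by (simp add: collinear_iff)
  moreover have "distinct [A, B, C]" "btw C B A"
    using b by (auto simp: btw_def open_segment_def closed_segment_commute)
  ultimately show "distinct [A, B, C] \<and> P.collinear A B C \<and> btw C B A" by blast
next
  fix B D :: point assume "B \<noteq> D"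
  define u where "u = D - B"
  have u: "u \<noteq> 0" "D = B + 1 *\<^sub>R u" "B = B + 0 *\<^sub>R u" using \<open>B \<noteq> D\<close> by (auto simp: u_def)
  have "inc (B + t *\<^sub>R u) (P.line B D)" for t
    using \<open>B \<noteq> D\<close> by (simp add: inc_line_iff u_def)
  \<comment> \<open>With \<open>B\<close> at parameter 0 and \<open>D\<close> at 1, the parameters
    -1, 1/2 and 2 provide the three points of \<open>O2\<close>.\<close>
  moreover have "btw (B + (-1) *\<^sub>R u) B D" "btw B (B + (1/2) *\<^sub>R u) D" "btw B D (B + 2 *\<^sub>R u)"
    using btw_line[OF u(1), of B "-1" 0 1] btw_line[OF u(1), of B 0 "1/2" 1]
      btw_line[OF u(1), of B 0 1 2] by (auto simp: u_def)
  ultimately show "\<exists>A C E. inc A (P.line B D) \<and> inc C (P.line B D) \<and> inc E (P.line B D) \<and>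
      btw A B D \<and> btw B C D \<and> btw B D E" by blast
next
  fix A B C :: point assume d: "distinct [A, B, C]" and "P.collinear A B C"
  then obtain s where s: "C - A = s *\<^sub>R (B - A)"
    using cross_eq_0[of "B - A" "C - A"] by (auto simp: collinear_iff)
  define u where "u = B - A"
  have u: "u \<noteq> 0" using d by (auto simp: u_def)
  have B: "B = A + 1 *\<^sub>R u" by (simp add: u_def)
  have C: "C = A + s *\<^sub>R u" using s by (simp add: u_def diff_eq_eq)
  have A: "A = A + 0 *\<^sub>R u" by simp
  have "s \<noteq> 0" "s \<noteq> 1" using d B C by auto
  \<comment> \<open>With \<open>A\<close> at 0, \<open>B\<close> at 1 and \<open>C\<close> at
    \<open>s\<close>, the position of \<open>s\<close> relative to 0 and 1 decides which point is
    the middle one.\<close>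
  moreover have "btw B A C \<longleftrightarrow> s < 0" "btw A B C \<longleftrightarrow> 1 < s" "btw A C B \<longleftrightarrow> 0 < s \<and> s < 1"
    using btw_line[OF u, of A 1 0 s] btw_line[OF u, of A 0 1 s] btw_line[OF u, of A 0 s 1]
    unfolding A[symmetric] B[symmetric] C[symmetric] by auto
  ultimately show "(btw B A C \<and> \<not> btw A B C \<and> \<not> btw A C B) \<or>
      (\<not> btw B A C \<and> btw A B C \<and> \<not> btw A C B) \<or>
      (\<not> btw B A C \<and> \<not> btw A B C \<and> btw A C B)" by auto
next
  fix l and A B C :: point
  show "P.same_side l A B \<Longrightarrow> P.same_side l B C \<Longrightarrow> P.same_side l A C"
    by (auto simp: same_side_iff zero_less_mult_iff)
  show "P.opposite_side l A B \<Longrightarrow> P.opposite_side l B C \<Longrightarrow> P.same_side l A C"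
    by (auto simp: same_side_iff opposite_side_iff zero_less_mult_iff mult_less_0_iff)
next
  fix A B A' Q :: point assume "A \<noteq> B" "A' \<noteq> Q"
  define u where "u = Q - A'"
  have u: "u \<noteq> 0" "len u > 0" using \<open>A' \<noteq> Q\<close> by (auto simp: u_def intro!: len_pos)
  have AB: "len (B - A) > 0" using \<open>A \<noteq> B\<close> by (simp add: len_pos)
  show "\<exists>!B'. B' \<noteq> A' \<and> B' \<in> P.ray A' Q \<and> scong (P.segment A B) (P.segment A' B')"
  \<comment> \<open>On a fixed ray the length is the parameter times \<open>len u\<close>, so the
    required length determines the parameter.\<close>
  proof (rule ex1I[of _ "A' + (len (B - A) / len u) *\<^sub>R u"])
    show "A' + (len (B - A) / len u) *\<^sub>R u \<noteq> A' \<and>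
      A' + (len (B - A) / len u) *\<^sub>R u \<in> P.ray A' Q \<and>
      scong (P.segment A B) (P.segment A' (A' + (len (B - A) / len u) *\<^sub>R u))"
      using u AB \<open>A' \<noteq> Q\<close>
      by (auto simp: ray_eq scong_iff len_simps halfline_def simp flip: u_def
          intro!: exI[of _ "len (B - A) / len u"])
  next
    fix X assume X: "X \<noteq> A' \<and> X \<in> P.ray A' Q \<and> scong (P.segment A B) (P.segment A' X)"
    then obtain t where "t \<ge> 0" "X = A' + t *\<^sub>R u"
      using \<open>A' \<noteq> Q\<close> by (auto simp: ray_eq halfline_def u_def)
    moreover from this X have "len (B - A) = t * len u" by (simp add: scong_iff len_simps)
    ultimately show "X = A' + (len (B - A) / len u) *\<^sub>R u" using u by simp
  qed
next
  fix A B C D E F :: point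
  show "scong (P.segment A B) (P.segment C D) \<Longrightarrow> scong (P.segment A B) (P.segment E F) \<Longrightarrow>
      scong (P.segment C D) (P.segment E F)" by (simp add: scong_iff)
  show "scong (P.segment A B) (P.segment A B)" by (simp add: scong_iff)
next
  fix A B C A' B' C' :: point
  assume b: "btw A B C" "btw A' B' C'"
    and c: "scong (P.segment A B) (P.segment A' B')" "scong (P.segment B C) (P.segment B' C')"
  \<comment> \<open>Parts of a segment share its direction, and \<open>len\<close> is homogeneous,
    so the rescaling is constant along a line and lengths add.\<close>
  have add: "len (C - A) = len (B - A) + len (C - B)" if b: "btw A B C" for A B C
  proof -
    obtain t where t: "0 < t" "t < 1" "B = A + t *\<^sub>R (C - A)" using b by (rule btwE)
    have "B - A = t *\<^sub>R (C - A)" "C - B = (1 - t) *\<^sub>R (C - A)"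
      using t(3) by (simp_all add: algebra_simps)
    then have "len (B - A) = t * len (C - A)" "len (C - B) = (1 - t) * len (C - A)"
      using t(1,2) by (simp_all add: len_simps)
    then show ?thesis by (simp add: algebra_simps)
  qed
  show "scong (P.segment A C) (P.segment A' C')"
    using c add[OF b(1)] add[OF b(2)] by (simp add: scong_iff)
next
  fix A B C A' B' Q :: point
  assume ang: "P.is_angle B A C" and ne: "A' \<noteq> B'" and Q: "\<not> inc Q (P.line A' B')"
  note BAC = is_angle_imp[OF ang]
  define u where "u = B' - A'"
  define c where "c = sgn (B - A) \<bullet> sgn (C - A)"
  have u: "u \<noteq> 0" using ne by (simp add: u_def)
  have s: "cross u (Q - A') \<noteq> 0" using Q ne by (simp add: inc_line_iff u_def)
  \<comment> \<open>The condition of \<open>C4\<close> depends only on the direction from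
    \<open>A'\<close> to \<open>X\<close>. For \<open>X = A'\<close> there is no ray direction, but
    then both sides fail because the side condition does.\<close>
  have char: "P.same_side (P.line A' B') X Q \<and> acong (P.angle B' A' X) (P.angle B A C) \<longleftrightarrow>
      cross u (X - A') * cross u (Q - A') > 0 \<and> sgn u \<bullet> sgn (X - A') = c" for X
  proof (cases "X = A'")
    case True
    then show ?thesis using ne by (simp add: same_side_line_iff)
  next
    case False
    then show ?thesis using ne BAC by (auto simp: same_side_line_iff angle_cong_iff c_def u_def)
  qed
  have "\<bar>c\<bar> < 1" unfolding c_def using BAC by (intro abs_cos_less_1)
  then obtain v where v: "v \<noteq> 0" "sgn u \<bullet> sgn v = c" "cross u v * cross u (Q - A') > 0"
    using exists_direction u s by blast
  show "\<exists>!r. \<exists>C'. r = P.ray A' C' \<and> P.same_side (P.line A' B') C' Q \<and>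
      acong (P.angle B' A' C') (P.angle B A C)"
    unfolding char
  proof (rule ex1I[of _ "P.ray A' (A' + v)"])
    show "\<exists>C'. P.ray A' (A' + v) = P.ray A' C' \<and>
        cross u (C' - A') * cross u (Q - A') > 0 \<and> sgn u \<bullet> sgn (C' - A') = c"
      using v by (intro exI[of _ "A' + v"]) simp
  next
    fix r assume "\<exists>C'. r = P.ray A' C' \<and>
        cross u (C' - A') * cross u (Q - A') > 0 \<and> sgn u \<bullet> sgn (C' - A') = c"
    then obtain X where X: "r = P.ray A' X"
        "cross u (X - A') * cross u (Q - A') > 0" "sgn u \<bullet> sgn (X - A') = c" by blast
    then have "X - A' \<noteq> 0" by auto
    moreover have "cross u (X - A') * cross u v > 0"
      using X(2) v(3) by (auto simp: zero_less_mult_iff)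
    ultimately have "sgn (X - A') = sgn v"
      using sgn_eq_if_same_side[of u "X - A'" v] u v X(3) by simp
    with \<open>X - A' \<noteq> 0\<close> v show "r = P.ray A' (A' + v)"
      by (simp add: X(1) ray_eq halfline_eq_iff)
  qed
next
  fix A B C D E F G H K :: point
  assume "P.is_angle A B C" "P.is_angle D E F" "P.is_angle G H K"
    "acong (P.angle A B C) (P.angle D E F)" "acong (P.angle A B C) (P.angle G H K)"
  then show "acong (P.angle D E F) (P.angle G H K)"
    by (simp add: angle_cong_iff is_angle_imp)
next
  fix A B C :: point
  assume "P.is_angle A B C"
  then show "acong (P.angle A B C) (P.angle A B C)"
    by (simp add: angle_cong_iff is_angle_imp)
qed

section \<open>The ray correspondence principle\<close>

text \<open>The linear map sending the unit vectors along \<open>u\<close>, \<open>v\<close> to those along \<open>u'\<close>, \<open>v'\<close> is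
  orthogonal, and it maps \<open>g\<close> to \<open>h\<close>.\<close>

lemma transport_direction:
  assumes uv: "cross u v \<noteq> 0" and uv': "cross u' v' \<noteq> 0"
    and cos: "sgn u \<bullet> sgn v = sgn u' \<bullet> sgn v'"
    and g: "cross u g * cross u v > 0" "cross v g * cross v u > 0"
  obtains h where "cross u' h * cross u' v' > 0" "cross v' h * cross v' u' > 0"
    "sgn u' \<bullet> sgn h = sgn u \<bullet> sgn g" "sgn h \<bullet> sgn v' = sgn g \<bullet> sgn v"
proof -
  have nz: "u \<noteq> 0" "v \<noteq> 0" "u' \<noteq> 0" "v' \<noteq> 0" using uv uv' by auto
  \<comment> \<open>By Cramer's rule, \<open>a\<close> and \<open>b\<close> are the coordinates of
    \<open>g\<close> in the basis \<open>sgn u\<close>, \<open>sgn v\<close>; the interior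
    conditions make both positive.\<close>
  define a where "a = norm u * (cross v g / cross v u)"
  define b where "b = norm v * (cross u g / cross u v)"
  have vu: "cross v u = - cross u v" "cross v' u' = - cross u' v'" by (rule cross_commute)+
  have "cross v g / cross v u > 0" "cross u g / cross u v > 0"
    using g by (simp_all add: zero_less_divide_iff zero_less_mult_iff)
  then have a: "a > 0" and b: "b > 0"
    unfolding a_def b_def using nz by (metis mult_pos_pos zero_less_norm_iff)+
  have a_u: "a *\<^sub>R sgn u = (cross v g / cross v u) *\<^sub>R u"
    and b_v: "b *\<^sub>R sgn v = (cross u g / cross u v) *\<^sub>R v"
    using nz by (simp_all add: a_def b_def sgn_div_norm)
  have "cross u v *\<^sub>R g = - cross v g *\<^sub>R u + cross u g *\<^sub>R v"
    by (simp add: cross_def prod_eq_iff algebra_simps)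
  then have "g = inverse (cross u v) *\<^sub>R (- cross v g *\<^sub>R u + cross u g *\<^sub>R v)"
    using uv by (metis left_inverse scaleR_one scaleR_scaleR)
  also have "\<dots> = a *\<^sub>R sgn u + b *\<^sub>R sgn v"
    using a_u b_v by (simp add: vu scaleR_add_right scaleR_diff_right divide_inverse mult.commute)
  finally have g_eq: "g = a *\<^sub>R sgn u + b *\<^sub>R sgn v" .
  \<comment> \<open>The same coordinates are used in the other basis. The two angles may be oriented
    differently, in which case the map is a reflection.\<close>
  define h where "h = a *\<^sub>R sgn u' + b *\<^sub>R sgn v'"
  \<comment> \<open>Both bases consist of unit vectors with the same scalar product, so lengths and
    angles computed from coordinates agree.\<close>
  have "g \<bullet> g = h \<bullet> h"
    using nz cos by (simp add: g_eq h_def inner_add inner_sgn_self inner_commute)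
  then have norm: "norm h = norm g" by (simp add: norm_eq_sqrt_inner)
  have "u' \<noteq> 0" "sgn u' \<bullet> h = sgn u \<bullet> g" "h \<bullet> sgn v' = g \<bullet> sgn v"
    using nz cos by (simp_all add: g_eq h_def inner_add inner_sgn_self inner_commute)
  then have cosines: "sgn u' \<bullet> sgn h = sgn u \<bullet> sgn g" "sgn h \<bullet> sgn v' = sgn g \<bullet> sgn v"
    using norm by (simp_all add: sgn_div_norm[of h] sgn_div_norm[of g])
  \<comment> \<open>Positivity of the coordinates places \<open>h\<close> inside the second angle,
    whatever its orientation.\<close>
  have "cross u' h = b / norm v' * cross u' v'" "cross v' h = a / norm u' * cross v' u'"
    by (simp_all add: h_def sgn_div_norm divide_inverse)
  moreover have "k * c * c > 0" if "k > 0" "c \<noteq> 0" for k c :: real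
    using that by (metis mult.assoc mult_pos_pos not_real_square_gt_zero)
  ultimately have "cross u' h * cross u' v' > 0" "cross v' h * cross v' u' > 0"
    using a b nz uv' vu(2) by simp_all
  with cosines show ?thesis using that by blast
qed

text \<open>Existence comes from \<open>transport_direction\<close>. For uniqueness one of the two
  angle congruences suffices, since interior points lie on a known side of the line
  \<open>ED\<close>.\<close>

lemma plane_RCT: "P.RCT"
  unfolding P.RCT_def
proof (intro allI impI ballI)
  fix A B C D E F G :: point
  assume ang: "P.is_angle A B C" "P.is_angle D E F"
    and cong: "acong (P.angle A B C) (P.angle D E F)" and G: "G \<in> P.angle_interior A B C"
  note ABC = is_angle_imp[OF ang(1)] and DEF = is_angle_imp[OF ang(2)]
  note int = angle_interior_iff[OF ABC(1,2)] angle_interior_iff[OF DEF(1,2)]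
  have GB: "G \<noteq> B" using G int by auto
  have HE: "H \<noteq> E" if "H \<in> P.angle_interior D E F" for H using that int by auto
  have char: "acong (P.angle G B C) (P.angle H E F) \<and> acong (P.angle A B G) (P.angle D E H) \<longleftrightarrow>
      sgn (G - B) \<bullet> sgn (C - B) = sgn (H - E) \<bullet> sgn (F - E) \<and>
      sgn (A - B) \<bullet> sgn (G - B) = sgn (D - E) \<bullet> sgn (H - E)"
    if "H \<in> P.angle_interior D E F" for H
    using HE[OF that] GB ABC DEF by (simp add: angle_cong_iff)
  have "sgn (A - B) \<bullet> sgn (C - B) = sgn (D - E) \<bullet> sgn (F - E)"
    using cong ABC DEF by (simp add: angle_cong_iff)
  moreover have "cross (A - B) (G - B) * cross (A - B) (C - B) > 0"
      "cross (C - B) (G - B) * cross (C - B) (A - B) > 0"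
    using G int by blast+
  ultimately obtain h where h: "cross (D - E) h * cross (D - E) (F - E) > 0"
      "cross (F - E) h * cross (F - E) (D - E) > 0"
      "sgn (D - E) \<bullet> sgn h = sgn (A - B) \<bullet> sgn (G - B)"
      "sgn h \<bullet> sgn (F - E) = sgn (G - B) \<bullet> sgn (C - B)"
    by (rule transport_direction[OF ABC(3) DEF(3)])
  have hint: "E + h \<in> P.angle_interior D E F" using h int by simp
  show "\<exists>!r. \<exists>H\<in>P.angle_interior D E F. r = P.ray E H \<and>
      acong (P.angle G B C) (P.angle H E F) \<and> acong (P.angle A B G) (P.angle D E H)"
  proof (rule ex1I[of _ "P.ray E (E + h)"])
    show "\<exists>H\<in>P.angle_interior D E F. P.ray E (E + h) = P.ray E H \<and>
      acong (P.angle G B C) (P.angle H E F) \<and> acong (P.angle A B G) (P.angle D E H)"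
      using hint char[OF hint] h by (intro bexI[of _ "E + h"]) auto
  next
    fix r assume "\<exists>H\<in>P.angle_interior D E F. r = P.ray E H \<and>
      acong (P.angle G B C) (P.angle H E F) \<and> acong (P.angle A B G) (P.angle D E H)"
    then obtain H where H: "H \<in> P.angle_interior D E F" "r = P.ray E H"
      "sgn (A - B) \<bullet> sgn (G - B) = sgn (D - E) \<bullet> sgn (H - E)"
      using char by blast
    have "cross (D - E) (H - E) * cross (D - E) h > 0"
      using H(1) h(1) int by (auto simp: zero_less_mult_iff)
    then have "sgn (H - E) = sgn h"
    proof (rule sgn_eq_if_same_side[rotated 3])
      show "D - E \<noteq> 0" "H - E \<noteq> 0" "h \<noteq> 0" using HE[OF H(1)] HE[OF hint] DEF(1) by auto
      show "sgn (D - E) \<bullet> sgn (H - E) = sgn (D - E) \<bullet> sgn h" using H(3) h(3) by simp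
    qed
    then show "r = P.ray E (E + h)"
      using HE[OF H(1)] HE[OF hint] by (simp add: H(2) ray_eq halfline_eq_iff)
  qed
qed

section \<open>Failure of ASA\<close>

lemma plane_not_ASA: "\<not> P.ASA"
proof
  assume ASA: "P.ASA"
  \<comment> \<open>The second triangle is the image of the first under multiplication by 1 + i in
    the complex plane, a similarity, so corresponding angles agree.\<close>
  define A B C D E F :: point
    where "A = (0, 0)" and "B = (1, 0)" and "C = (0, 1)"
      and "D = (0, 0)" and "E = (1, 1)" and "F = (-1, 1)"
  note pts = A_def B_def C_def D_def E_def F_def
  have tri: "P.is_triangle A B C" "P.is_triangle D E F"
    by (simp_all add: P.is_triangle_def collinear_iff cross_def pts)
  have diff: "A - B = (-1, 0)" "C - B = (-1, 1)" "D - E = (-1, -1)" "F - E = (-2, 0)"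
    "B - A = (1, 0)" "C - A = (0, 1)" "E - D = (1, 1)" "F - D = (-1, 1)"
    by (simp_all add: pts)
  then have ne: "A \<noteq> B" "C \<noteq> B" "D \<noteq> E" "F \<noteq> E" "B \<noteq> A" "C \<noteq> A" "E \<noteq> D" "F \<noteq> D"
    by (auto simp: pts)
  have norm: "norm (-1::real, 0::real) = 1" "norm (-1::real, 1::real) = sqrt 2"
      "norm (-1::real, -1::real) = sqrt 2" "norm (-2::real, 0::real) = 2"
    by (simp_all add: norm_Pair)
  have "sgn (B - A) \<bullet> sgn (C - A) = sgn (E - D) \<bullet> sgn (F - D)"
    unfolding diff sgn_div_norm by simp
  then have angA: "acong (P.angle B A C) (P.angle E D F)"
    using ne by (simp only: angle_cong_iff not_False_eq_True)
  have "sgn (A - B) \<bullet> sgn (C - B) = sgn (D - E) \<bullet> sgn (F - E)"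
    unfolding diff sgn_div_norm norm by simp
  then have angB: "acong (P.angle A B C) (P.angle D E F)"
    using ne by (simp only: angle_cong_iff not_False_eq_True)
  \<comment> \<open>The projection of the diagonal leg \<open>DE\<close> has length 1, the same as
    the horizontal leg \<open>AB\<close>.\<close>
  have "scong (P.segment A B) (P.segment D E)"
    by (simp add: scong_iff len_def diff)
  then have "P.triangle_cong A B C D E F"
    using ASA[unfolded P.ASA_def, rule_format, OF tri angA _ angB] by simp
  \<comment> \<open>The hypotenuses contradict this: \<open>BC\<close> projects to length 1, while
    the horizontal segment \<open>EF\<close> has length 2.\<close>
  then have "scong (P.segment B C) (P.segment E F)" by (simp add: P.triangle_cong_def)
  then show False by (simp add: scong_iff len_def pts)
qed

theorem mainTheorem4:
  "\<not> (\<forall>(incid :: real \<times> real \<Rightarrow> (real \<times> real) + real \<Rightarrow> bool) betw seg_cong ang_cong.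
        M_minus incid betw seg_cong ang_cong \<longrightarrow>
        plane_structure.RCT incid betw ang_cong \<longrightarrow>
        plane_structure.ASA incid betw seg_cong ang_cong)"
  using plane_M_minus plane_RCT plane_not_ASA by blast

end
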